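(* Let $\Gamma$, $D$, $q$, $H$, the vector space $\Lambda$ and the maps $A^{(i)},A^{*(i)}$ be as described in the context. View $\Lambda$ as the $U'_q(\mathfrak{so}_6)$-module on which \[ B_1=\frac{A^{(1)}}{H(q^2-q^{-2})},\quad B_3=\frac{A^{(2)}}{H(q^2-q^{-2})},\quad B_5=\frac{A^{(3)}}{H(q^2-q^{-2})},\quad B_2=\frac{A^{*(3)}}{H(q^{-2}-q^{2})},\quad B_4=\frac{A^{*(1)}}{H(q^{-2}-q^{2})},\quad B_6=\frac{A^{*(2)}}{H(q^{-2}-q^{2})}. \] This $U'_q(\mathfrak{so}_6)$-module is irreducible.
   Context: GRAPH SETTING. $\Gamma=(X,\mathcal R)$ is a finite undirected connected graph without loops or multiple edges, with vertex set $X$, $|X|\ge 2$, path-length distance $\partial$ and diameter $D=\max\{\partial(x,y)\mid x,y\in X\}$. Write $\Gamma_i(x)=\{y\in X\mid\partial(x,y)=i\}$ and $\Gamma(x)=\Gamma_1(x)$. $\Gamma$ is distance-regular: for $0\le h,i,j\le D$ and $\partial(x,y)=h$, the number $p^h_{i,j}=|\Gamma_i(x)\cap\Gamma_j(y)|$ depends only on $h,i,j$. Put $c_i=p^i_{1,i-1}$, $a_i=p^i_{1,i}$, $b_i=p^i_{1,i+1}$ ($c_0=0$, $b_D=0$), $k_i=p^0_{i,i}$. $V$ is the complex vector space with basis $X$. For $0\le i\le D$, $A_i\in\mathrm{End}(V)$ sends $x\mapsto\sum_{\xi\in\Gamma_i(x)}\xi$; $A=A_1$. The $A_i$ form a basis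 of a commutative algebra $M\subseteq\mathrm{End}(V)$ generated by $A$. The primitive idempotents $E_0,\dots,E_D$ are the basis of $M$ with $E_iE_j=\delta_{i,j}E_i$, $\sum_iE_i=I$, $E_0=|X|^{-1}\sum_iA_i$. The Krein parameters $q^h_{i,j}$ are given by $E_i\circ E_j=|X|^{-1}\sum_hq^h_{i,j}E_h$, where $\circ$ is the entrywise product of matrices with respect to the basis $X$. The ordering $E_0,\dots,E_D$ is $Q$-polynomial if for all $0\le h,i,j\le D$: $q^h_{i,j}=0$ when one of $h,i,j$ exceeds the sum of the other two, and $q^h_{i,j}\ne0$ when one of them equals the sum of the other two; $\Gamma$ is $Q$-polynomial if such an ordering exists. $\theta_i$ is defined by $AE_i=\theta_iE_i$, and $\theta^*_i$ by $E_1=|X|^{-1}\sum_{i=0}^D\theta^*_iA_i$. $\Gamma$ is bipartite if $a_i=0$ for all $i$; a bipartite $\Gamma$ is called 2-homogeneous if $k_D=1$ (antipodal 2-cover) and $\Gamma$ is $Q$-polynomial. ASSUMPTION. $D\ge3$, $\Gamma$ is 2-homogeneous bipartite, not a hypercube and not a cycle, and $\{E_i\}_{i=0}^D$ is a fixed $Q$-polynomial ordering. Then there is a nonzero $q\in\mathbb C$, not a root of unity, which we fix, such that for $0\le i\le D$: $\theta_i=\theta^*_i=H\sqrt{-1}\,(q^{D-2i}-q^{2i-D})$, $c_i=H\sqrt{-1}\,\frac{q^{2i}-q^{-2i}}{q^{D-2i}+q^{2i-D}}$, $b_i=H\sqrt{-1}\,\frac{q^{2D-2i}-q^{2i-2D}}{q^{D-2i}+q^{2i-D}}$,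 where $H=\sqrt{-1}\,\frac{q^{D-2}+q^{2-D}}{q^{-2}-q^{2}}$. THE SPACE $\Lambda$ AND THE SIX MAPS. $V^{\otimes3}=V\otimes V\otimes V$. $\mathcal P_D$ is the set of $(r,s,t,u)\in\mathbb N^4$ ($0\in\mathbb N$) with $r+s+t+u=D$. Every $x,y,z\in X$ have a unique profile $(r,s,t,u)\in\mathcal P_D$, determined by $\partial(x,y)=s+t$, $\partial(y,z)=t+u$, $\partial(z,x)=u+s$. For $(r,s,t,u)\in\mathcal P_D$, $B(r,s,t,u)=\sum x\otimes y\otimes z$ over all triples $x,y,z\in X$ of profile $(r,s,t,u)$. $\Lambda$ is the subspace of $V^{\otimes3}$ with basis $\{B(r,s,t,u)\}_{(r,s,t,u)\in\mathcal P_D}$. The maps in $\mathrm{End}(V^{\otimes3})$ are, for $x,y,z\in X$: $A^{(1)}(x\otimes y\otimes z)=\sum_{\xi\in\Gamma(x)}\xi\otimes y\otimes z$, $A^{(2)}(x\otimes y\otimes z)=\sum_{\xi\in\Gamma(y)}x\otimes\xi\otimes z$, $A^{(3)}(x\otimes y\otimes z)=\sum_{\xi\in\Gamma(z)}x\otimes y\otimes\xi$, $A^{*(1)}(x\otimes y\otimes z)=\theta^*_{\partial(y,z)}x\otimes y\otimes z$, $A^{*(2)}(x\otimes y\otimes z)=\theta^*_{\partial(z,x)}x\otimes y\otimes z$, $A^{*(3)}(x\otimes y\otimes z)=\theta^*_{\partial(x,y)}x\otimes y\otimes z$. All six leave $\Lambda$ invariant, and in the claim they denote the restrictions to $\Lambda$.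 THE ALGEBRA $U'_q(\mathfrak{so}_6)$. It is the associative unital complex algebra with generators $B_1,\dots,B_5$ and relations: $B_i^2B_j-(q^2+q^{-2})B_iB_jB_i+B_jB_i^2=-B_j$ if $|i-j|=1$; $B_iB_j=B_jB_i$ if $|i-j|\ge2$. With $[R,S]_q=qRS-q^{-1}SR$, the element $B_6$ is defined by $B_6=-[B_1,[B_2,[B_3,[B_4,B_5]_q]_q]_q]_q$. The displayed formulas in the claim do define a $U'_q(\mathfrak{so}_6)$-module structure on $\Lambda$. *)

theory Defs
  imports
    "HOL-Analysis.Analysis"
    "HOL-Algebra.QuotRing"
    "HOL-Library.Poly_Mapping"
begin

section \<open>Distance-regular graphs\<close>

text \<open>
  A graph has the finite type \<open>'x\<close> as its vertex set and is given by its adjacency relation.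
\<close>

definition simple_graph :: "('x \<Rightarrow> 'x \<Rightarrow> bool) \<Rightarrow> bool" where
  "simple_graph adj \<longleftrightarrow> symp adj \<and> irreflp adj"

definition connected_graph :: "('x \<Rightarrow> 'x \<Rightarrow> bool) \<Rightarrow> bool" where
  "connected_graph adj \<longleftrightarrow> (\<forall>x y. adj\<^sup>*\<^sup>* x y)"

text \<open>\<open>(adj ^^ n) x y\<close> says that there is a walk of length \<open>n\<close>; a shortest walk is a path.\<close>

definition gdist :: "('x \<Rightarrow> 'x \<Rightarrow> bool) \<Rightarrow> 'x \<Rightarrow> 'x \<Rightarrow> nat" where
  "gdist adj x y = (LEAST n. (adj ^^ n) x y)"

definition graph_diameter :: "('x::finite \<Rightarrow> 'x \<Rightarrow> bool) \<Rightarrow> nat" where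
  "graph_diameter adj = Max {gdist adj x y | x y. True}"

definition gsphere :: "('x \<Rightarrow> 'x \<Rightarrow> bool) \<Rightarrow> nat \<Rightarrow> 'x \<Rightarrow> 'x set" where
  "gsphere adj i x = {y. gdist adj x y = i}"

definition distance_regular :: "('x::finite \<Rightarrow> 'x \<Rightarrow> bool) \<Rightarrow> bool" where
  "distance_regular adj \<longleftrightarrow>
     simple_graph adj \<and> connected_graph adj \<and>
     (\<forall>h\<le>graph_diameter adj. \<forall>i\<le>graph_diameter adj. \<forall>j\<le>graph_diameter adj. \<exists>p. \<forall>x y.
        gdist adj x y = h \<longrightarrow> card (gsphere adj i x \<inter> gsphere adj j y) = p)"

text \<open>\<open>int_num adj h i j\<close> is $p^h_{i,j}$.\<close>

definition int_num :: "('x::finite \<Rightarrow> 'x \<Rightarrow> bool) \<Rightarrow> nat \<Rightarrow> nat \<Rightarrow> nat \<Rightarrow> nat" where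
  "int_num adj h i j =
     (THE p. \<forall>x y. gdist adj x y = h \<longrightarrow> card (gsphere adj i x \<inter> gsphere adj j y) = p)"

definition c_num :: "('x::finite \<Rightarrow> 'x \<Rightarrow> bool) \<Rightarrow> nat \<Rightarrow> nat" where
  "c_num adj i = (if i = 0 then 0 else int_num adj i 1 (i - 1))"

definition a_num :: "('x::finite \<Rightarrow> 'x \<Rightarrow> bool) \<Rightarrow> nat \<Rightarrow> nat" where
  "a_num adj i = int_num adj i 1 i"

definition b_num :: "('x::finite \<Rightarrow> 'x \<Rightarrow> bool) \<Rightarrow> nat \<Rightarrow> nat" where
  "b_num adj i = (if i = graph_diameter adj then 0 else int_num adj i 1 (i + 1))"

definition k_num :: "('x::finite \<Rightarrow> 'x \<Rightarrow> bool) \<Rightarrow> nat \<Rightarrow> nat" where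
  "k_num adj i = int_num adj 0 i i"

definition bipartite_drg :: "('x::finite \<Rightarrow> 'x \<Rightarrow> bool) \<Rightarrow> bool" where
  "bipartite_drg adj \<longleftrightarrow> (\<forall>i\<le>graph_diameter adj. a_num adj i = 0)"

definition is_hypercube :: "('x \<Rightarrow> 'x \<Rightarrow> bool) \<Rightarrow> bool" where
  "is_hypercube adj \<longleftrightarrow>
     (\<exists>n f. bij_betw f UNIV {w :: bool list. length w = n} \<and>
        (\<forall>x y. adj x y \<longleftrightarrow> card {i. i < n \<and> f x ! i \<noteq> f y ! i} = 1))"

definition is_cycle :: "('x \<Rightarrow> 'x \<Rightarrow> bool) \<Rightarrow> bool" where
  "is_cycle adj \<longleftrightarrow>
     (\<exists>n\<ge>3. \<exists>f :: 'x \<Rightarrow> nat. bij_betw f UNIV {..<n} \<and>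
        (\<forall>x y. adj x y \<longleftrightarrow> f y = (f x + 1) mod n \<or> f x = (f y + 1) mod n))"


section \<open>The Bose-Mesner algebra and the Q-polynomial property\<close>

text \<open>
  \<open>V\<close> is \<open>complex ^ 'x\<close>, and \<open>End(V)\<close> is identified with the matrices
  \<open>complex ^ 'x ^ 'x\<close>, whose \<open>(y,x)\<close>-entry is the coefficient of \<open>y\<close> in the image of \<open>x\<close>.
  Complex scalar multiplication of matrices is not in the library.
\<close>

definition mscale :: "complex \<Rightarrow> complex ^ 'n ^ 'm \<Rightarrow> complex ^ 'n ^ 'm" where
  "mscale c M = (\<chi> i j. c * M $ i $ j)"

interpretation mat: vector_space "mscale :: complex \<Rightarrow> complex ^ 'n ^ 'm \<Rightarrow> complex ^ 'n ^ 'm"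
  by unfold_locales (simp_all add: mscale_def vec_eq_iff algebra_simps)

definition hadamard :: "complex ^ 'n ^ 'm \<Rightarrow> complex ^ 'n ^ 'm \<Rightarrow> complex ^ 'n ^ 'm" where
  "hadamard M N = (\<chi> i j. M $ i $ j * N $ i $ j)"

definition dist_mat :: "('x::finite \<Rightarrow> 'x \<Rightarrow> bool) \<Rightarrow> nat \<Rightarrow> complex ^ 'x ^ 'x" where
  "dist_mat adj i = (\<chi> y x. if y \<in> gsphere adj i x then 1 else 0)"

definition bose_mesner :: "('x::finite \<Rightarrow> 'x \<Rightarrow> bool) \<Rightarrow> (complex ^ 'x ^ 'x) set" where
  "bose_mesner adj = mat.span (dist_mat adj ` {..graph_diameter adj})"

text \<open>\<open>E 0, \<dots>, E D\<close> is an ordering of the primitive idempotents of \<open>M\<close> with \<open>E 0\<close> the trivial one.\<close>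

definition idempotent_ordering ::
    "('x::finite \<Rightarrow> 'x \<Rightarrow> bool) \<Rightarrow> (nat \<Rightarrow> complex ^ 'x ^ 'x) \<Rightarrow> bool" where
  "idempotent_ordering adj E \<longleftrightarrow>
     (let D = graph_diameter adj in
        inj_on E {..D} \<and> mat.independent (E ` {..D}) \<and> mat.span (E ` {..D}) = bose_mesner adj \<and>
        (\<forall>i\<le>D. \<forall>j\<le>D. E i ** E j = (if i = j then E i else 0)) \<and>
        (\<Sum>i\<le>D. E i) = mat 1 \<and>
        E 0 = mscale (1 / of_nat CARD('x)) (\<Sum>i\<le>D. dist_mat adj i))"

text \<open>
  \<open>krein adj E h i j\<close> is $q^h_{i,j}$, the coefficient of \<open>E h\<close> in
  $|X| \, E_i \circ E_j$; the coefficient function is made unique by requiring it to vanish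
  beyond \<open>D\<close>.  The same device is used for \<open>theta_star\<close>.
\<close>

definition krein ::
    "('x::finite \<Rightarrow> 'x \<Rightarrow> bool) \<Rightarrow> (nat \<Rightarrow> complex ^ 'x ^ 'x) \<Rightarrow> nat \<Rightarrow> nat \<Rightarrow> nat \<Rightarrow> complex" where
  "krein adj E h i j =
     (THE f. (\<forall>l>graph_diameter adj. f l = 0) \<and>
        hadamard (E i) (E j) =
          mscale (1 / of_nat CARD('x)) (\<Sum>l\<le>graph_diameter adj. mscale (f l) (E l))) h"

definition Q_poly_ordering ::
    "('x::finite \<Rightarrow> 'x \<Rightarrow> bool) \<Rightarrow> (nat \<Rightarrow> complex ^ 'x ^ 'x) \<Rightarrow> bool" where
  "Q_poly_ordering adj E \<longleftrightarrow>
     idempotent_ordering adj E \<and>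
     (\<forall>h\<le>graph_diameter adj. \<forall>i\<le>graph_diameter adj. \<forall>j\<le>graph_diameter adj.
        (h > i + j \<or> i > h + j \<or> j > h + i \<longrightarrow> krein adj E h i j = 0) \<and>
        (h = i + j \<or> i = h + j \<or> j = h + i \<longrightarrow> krein adj E h i j \<noteq> 0))"

definition theta_eig ::
    "('x::finite \<Rightarrow> 'x \<Rightarrow> bool) \<Rightarrow> (nat \<Rightarrow> complex ^ 'x ^ 'x) \<Rightarrow> nat \<Rightarrow> complex" where
  "theta_eig adj E i = (THE \<theta>. dist_mat adj 1 ** E i = mscale \<theta> (E i))"

definition theta_star ::
    "('x::finite \<Rightarrow> 'x \<Rightarrow> bool) \<Rightarrow> (nat \<Rightarrow> complex ^ 'x ^ 'x) \<Rightarrow> nat \<Rightarrow> complex" where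
  "theta_star adj E i =
     (THE f. (\<forall>l>graph_diameter adj. f l = 0) \<and>
        E 1 = mscale (1 / of_nat CARD('x))
                (\<Sum>l\<le>graph_diameter adj. mscale (f l) (dist_mat adj l))) i"

definition two_homogeneous :: "('x::finite \<Rightarrow> 'x \<Rightarrow> bool) \<Rightarrow> bool" where
  "two_homogeneous adj \<longleftrightarrow>
     bipartite_drg adj \<and> k_num adj (graph_diameter adj) = 1 \<and> (\<exists>E. Q_poly_ordering adj E)"

definition H_const :: "nat \<Rightarrow> complex \<Rightarrow> complex" where
  "H_const D q =
     \<i> * (q powi (int D - 2) + q powi (2 - int D)) / (q powi (-2) - q powi 2)"


section \<open>The space \<open>\<Lambda>\<close> and the six maps\<close>

text \<open>
  As \<open>V\<close> has basis \<open>X\<close>, the third tensor power of \<open>V\<close> is the space with basis \<open>X \<times> X \<times> X\<close>.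
\<close>

type_synonym 'x tensor3 = "complex ^ ('x \<times> 'x \<times> 'x)"

definition tens :: "'x \<Rightarrow> 'x \<Rightarrow> 'x \<Rightarrow> ('x::finite) tensor3" where
  "tens x y z = axis (x, y, z) 1"

definition lin_ext :: "('x \<Rightarrow> 'x \<Rightarrow> 'x \<Rightarrow> 'x tensor3) \<Rightarrow> ('x::finite) tensor3 \<Rightarrow> 'x tensor3" where
  "lin_ext f v = (\<Sum>x\<in>UNIV. \<Sum>y\<in>UNIV. \<Sum>z\<in>UNIV. v $ (x, y, z) *s f x y z)"

lemma lin_ext_linear: "Vector_Spaces.linear (*s) (*s) (lin_ext f)"
  by unfold_locales
     (simp_all add: lin_ext_def vec.scale_left_distrib sum.distrib vec.scale_sum_right)

lemma lin_ext_tens: "lin_ext f (tens x y z) = f x y z"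
proof -
  have "lin_ext f (tens x y z) =
      (\<Sum>a\<in>UNIV. \<Sum>b\<in>UNIV. \<Sum>c\<in>UNIV. if c = z then (if b = y then (if a = x then f a b c else 0) else 0) else 0)"
    unfolding lin_ext_def tens_def axis_def by (intro sum.cong refl) auto
  then show ?thesis by simp
qed

definition A_one :: "('x::finite \<Rightarrow> 'x \<Rightarrow> bool) \<Rightarrow> 'x tensor3 \<Rightarrow> 'x tensor3" where
  "A_one adj = lin_ext (\<lambda>x y z. \<Sum>\<xi>\<in>gsphere adj 1 x. tens \<xi> y z)"

definition A_two :: "('x::finite \<Rightarrow> 'x \<Rightarrow> bool) \<Rightarrow> 'x tensor3 \<Rightarrow> 'x tensor3" where
  "A_two adj = lin_ext (\<lambda>x y z. \<Sum>\<xi>\<in>gsphere adj 1 y. tens x \<xi> z)"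

definition A_three :: "('x::finite \<Rightarrow> 'x \<Rightarrow> bool) \<Rightarrow> 'x tensor3 \<Rightarrow> 'x tensor3" where
  "A_three adj = lin_ext (\<lambda>x y z. \<Sum>\<xi>\<in>gsphere adj 1 z. tens x y \<xi>)"

definition Astar_one ::
    "('x::finite \<Rightarrow> 'x \<Rightarrow> bool) \<Rightarrow> (nat \<Rightarrow> complex ^ 'x ^ 'x) \<Rightarrow> 'x tensor3 \<Rightarrow> 'x tensor3" where
  "Astar_one adj E = lin_ext (\<lambda>x y z. theta_star adj E (gdist adj y z) *s tens x y z)"

definition Astar_two ::
    "('x::finite \<Rightarrow> 'x \<Rightarrow> bool) \<Rightarrow> (nat \<Rightarrow> complex ^ 'x ^ 'x) \<Rightarrow> 'x tensor3 \<Rightarrow> 'x tensor3" where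
  "Astar_two adj E = lin_ext (\<lambda>x y z. theta_star adj E (gdist adj z x) *s tens x y z)"

definition Astar_three ::
    "('x::finite \<Rightarrow> 'x \<Rightarrow> bool) \<Rightarrow> (nat \<Rightarrow> complex ^ 'x ^ 'x) \<Rightarrow> 'x tensor3 \<Rightarrow> 'x tensor3" where
  "Astar_three adj E = lin_ext (\<lambda>x y z. theta_star adj E (gdist adj x y) *s tens x y z)"

definition profiles :: "nat \<Rightarrow> (nat \<times> nat \<times> nat \<times> nat) set" where
  "profiles D = {(r, s, t, u). r + s + t + u = D}"

definition profile_triples ::
    "('x::finite \<Rightarrow> 'x \<Rightarrow> bool) \<Rightarrow> nat \<times> nat \<times> nat \<times> nat \<Rightarrow> ('x \<times> 'x \<times> 'x) set" where
  "profile_triples adj = (\<lambda>(r, s, t, u).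
     {(x, y, z). gdist adj x y = s + t \<and> gdist adj y z = t + u \<and> gdist adj z x = u + s})"

definition B_vec :: "('x::finite \<Rightarrow> 'x \<Rightarrow> bool) \<Rightarrow> nat \<times> nat \<times> nat \<times> nat \<Rightarrow> 'x tensor3" where
  "B_vec adj p = (\<Sum>(x, y, z)\<in>profile_triples adj p. tens x y z)"

definition Lambda :: "('x::finite \<Rightarrow> 'x \<Rightarrow> bool) \<Rightarrow> 'x tensor3 set" where
  "Lambda adj = vec.span (B_vec adj ` profiles (graph_diameter adj))"


section \<open>The algebra $U'_q(\mathfrak{so}_6)$\<close>

text \<open>
  The free complex algebra on \<open>B\<^sub>1, \<dots>, B\<^sub>5\<close> is the monoid algebra of the free monoid
  of words; \<open>Poly_Mapping\<close> supplies its (convolution) ring structure.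
\<close>

datatype so6_gen = G1 | G2 | G3 | G4 | G5

primrec gen_index :: "so6_gen \<Rightarrow> int" where
  "gen_index G1 = 1"
| "gen_index G2 = 2"
| "gen_index G3 = 3"
| "gen_index G4 = 4"
| "gen_index G5 = 5"

datatype so6_word = Word (letters: "so6_gen list")

instantiation so6_word :: monoid_add
begin

definition "0 = Word []"

definition "v + w = Word (letters v @ letters w)"

instance
  by standard (simp_all add: zero_so6_word_def plus_so6_word_def)

end

type_synonym so6_free = "so6_word \<Rightarrow>\<^sub>0 complex"

definition fgen :: "so6_gen \<Rightarrow> so6_free" where
  "fgen g = Poly_Mapping.single (Word [g]) 1"

definition fscalar :: "complex \<Rightarrow> so6_free" where
  "fscalar c = Poly_Mapping.single 0 c"

definition fcomm :: "complex \<Rightarrow> so6_free \<Rightarrow> so6_free \<Rightarrow> so6_free" where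
  "fcomm q R S = fscalar q * R * S - fscalar (inverse q) * S * R"

text \<open>
  The element \<open>B\<^sub>6\<close> is built in the free algebra; its image under \<open>Uclass\<close> below is the one in
  $U'_q(\mathfrak{so}_6)$.
\<close>

definition fB6 :: "complex \<Rightarrow> so6_free" where
  "fB6 q = - fcomm q (fgen G1) (fcomm q (fgen G2) (fcomm q (fgen G3) (fcomm q (fgen G4) (fgen G5))))"

definition so6_relators :: "complex \<Rightarrow> so6_free set" where
  "so6_relators q =
     {fgen i * fgen i * fgen j - fscalar (q powi 2 + q powi (-2)) * fgen i * fgen j * fgen i
        + fgen j * fgen i * fgen i + fgen j | i j. \<bar>gen_index i - gen_index j\<bar> = 1}
     \<union> {fgen i * fgen j - fgen j * fgen i | i j. \<bar>gen_index i - gen_index j\<bar> \<ge> 2}"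

definition free_ring :: "so6_free ring" where
  "free_ring = \<lparr>carrier = UNIV, monoid.mult = (*), one = 1, ring.zero = 0, add = (+)\<rparr>"

definition so6_ideal :: "complex \<Rightarrow> so6_free set" where
  "so6_ideal q = genideal free_ring (so6_relators q)"

definition Uq_so6 :: "complex \<Rightarrow> so6_free set ring" where
  "Uq_so6 q = free_ring Quot so6_ideal q"

text \<open>The image in $U'_q(\mathfrak{so}_6)$ of an element of the free algebra.\<close>

definition Uclass :: "complex \<Rightarrow> so6_free \<Rightarrow> so6_free set" where
  "Uclass q f = so6_ideal q +>\<^bsub>free_ring\<^esub> f"

lemma ring_free_ring: "Ring.ring free_ring"
proof (rule Ring.ringI)
  show "abelian_group free_ring"
  proof (rule abelian_groupI)
    fix x assume "x \<in> carrier free_ring"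
    have "- x \<oplus>\<^bsub>free_ring\<^esub> x = \<zero>\<^bsub>free_ring\<^esub>" by (simp add: free_ring_def)
    then show "\<exists>y\<in>carrier free_ring. y \<oplus>\<^bsub>free_ring\<^esub> x = \<zero>\<^bsub>free_ring\<^esub>"
      by (intro bexI[of _ "- x"]) (simp_all add: free_ring_def)
  qed (simp_all add: free_ring_def algebra_simps)
  show "Group.monoid free_ring"
    by (rule Group.monoidI) (simp_all add: free_ring_def mult.assoc)
qed (simp_all add: free_ring_def algebra_simps)

lemma ring_Uq_so6: "Ring.ring (Uq_so6 q)"
  unfolding Uq_so6_def so6_ideal_def
  by (intro ideal.quotient_is_ring ring.genideal_ideal ring_free_ring) (simp add: free_ring_def)


section \<open>Modules\<close>

text \<open>
  \<open>act\<close> makes the complex subspace \<open>W\<close> a unital left $U'_q(\mathfrak{so}_6)$-module.  The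
  last condition says that the scalars of the algebra act as the scalars of \<open>W\<close>.
\<close>

definition Uq_module ::
    "complex \<Rightarrow> (complex ^ 'n) set \<Rightarrow> (so6_free set \<Rightarrow> complex ^ 'n \<Rightarrow> complex ^ 'n) \<Rightarrow> bool" where
  "Uq_module q W act \<longleftrightarrow>
     vec.subspace W \<and>
     (\<forall>a\<in>carrier (Uq_so6 q). \<forall>v\<in>W. act a v \<in> W) \<and>
     (\<forall>a\<in>carrier (Uq_so6 q). \<forall>v\<in>W. \<forall>w\<in>W. act a (v + w) = act a v + act a w) \<and>
     (\<forall>a\<in>carrier (Uq_so6 q). \<forall>b\<in>carrier (Uq_so6 q). \<forall>v\<in>W.
        act (a \<oplus>\<^bsub>Uq_so6 q\<^esub> b) v = act a v + act b v) \<and>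
     (\<forall>a\<in>carrier (Uq_so6 q). \<forall>b\<in>carrier (Uq_so6 q). \<forall>v\<in>W.
        act (a \<otimes>\<^bsub>Uq_so6 q\<^esub> b) v = act a (act b v)) \<and>
     (\<forall>v\<in>W. act \<one>\<^bsub>Uq_so6 q\<^esub> v = v) \<and>
     (\<forall>c. \<forall>v\<in>W. act (Uclass q (fscalar c)) v = c *s v)"

definition Uq_submodule ::
    "complex \<Rightarrow> (complex ^ 'n) set \<Rightarrow> (so6_free set \<Rightarrow> complex ^ 'n \<Rightarrow> complex ^ 'n) \<Rightarrow>
     (complex ^ 'n) set \<Rightarrow> bool" where
  "Uq_submodule q W act S \<longleftrightarrow>
     vec.subspace S \<and> S \<subseteq> W \<and> (\<forall>a\<in>carrier (Uq_so6 q). \<forall>v\<in>S. act a v \<in> S)"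

definition Uq_irreducible ::
    "complex \<Rightarrow> (complex ^ 'n) set \<Rightarrow> (so6_free set \<Rightarrow> complex ^ 'n \<Rightarrow> complex ^ 'n) \<Rightarrow> bool" where
  "Uq_irreducible q W act \<longleftrightarrow>
     W \<noteq> {0} \<and> (\<forall>S. Uq_submodule q W act S \<longrightarrow> S = {0} \<or> S = W)"

end

theory Submission
  imports Defs
begin

text \<open>
  The dual maps \<open>A\<^sup>*\<close> are diagonal on the basis \<open>x \<otimes> y \<otimes> z\<close>, and their
  eigenvalues at a triple are \<open>\<theta>\<^sup>*\<close> of its three mutual distances.  As \<open>q\<close> is not a
  root of unity, the \<open>\<theta>\<^sup>*\<^sub>i\<close> are distinct (\<open>theta_star_formula_inj\<close>), so Lagrange
  interpolation in the \<open>A\<^sup>*\<close> cuts a vector down to the triples with prescribed distances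
  (\<open>closed_under_restriction\<close>).  The coordinates of a vector of \<open>\<Lambda>\<close> depend only on these
  distances (\<open>Lambda_nth_cong\<close>).  Hence, as soon as some vector of a submodule \<open>S\<close> has a
  nonzero coordinate at a triple, \<open>S\<close> contains the indicator vector of all triples with the
  same distances (\<open>class_vec_mem\<close>).

  The maps \<open>A\<close> now connect the classes.  Moving one entry of a triple \<open>t\<close> to an adjacent
  vertex gives a triple \<open>t'\<close> at which the image under the corresponding \<open>A\<close> of the indicator
  vector of the class of \<open>t\<close> has a positive integer coordinate, so the class of \<open>t'\<close> is in
  \<open>S\<close> whenever that of \<open>t\<close> is.  The graph being connected, every triple is reached from every
  other one by such moves, so a nonzero \<open>S\<close> contains all classes and equals \<open>\<Lambda>\<close>
  (\<open>invariant_subspace_eq_Lambda\<close>).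
\<close>

section \<open>Coordinates of the six maps and of vectors in \<open>\<Lambda>\<close>\<close>

lemma lin_ext_nth:
  "lin_ext f v $ t = (\<Sum>x\<in>UNIV. \<Sum>y\<in>UNIV. \<Sum>z\<in>UNIV. v $ (x, y, z) * f x y z $ t)"
  by (simp add: lin_ext_def)

lemma tens_nth: "tens x y z $ t = (if t = (x, y, z) then 1 else 0)"
  by (auto simp: tens_def axis_def)

lemma lin_ext_diagonal_nth:
  "lin_ext (\<lambda>x y z. h x y z *s tens x y z) v $ (a, b, c) = h a b c * v $ (a, b, c)"
proof -
  have "lin_ext (\<lambda>x y z. h x y z *s tens x y z) v $ (a, b, c) =
      (\<Sum>x\<in>UNIV. \<Sum>y\<in>UNIV. \<Sum>z\<in>UNIV.
         if z = c then (if y = b then (if x = a then h x y z * v $ (x, y, z) else 0) else 0) else 0)"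
    unfolding lin_ext_nth by (intro sum.cong refl) (auto simp: tens_nth)
  then show ?thesis by simp
qed

lemma sum_tens_nth:
  "(\<Sum>\<xi>\<in>M. tens \<xi> y z) $ (a, b, c) = (if b = y \<and> c = z \<and> a \<in> M then 1 else 0)"
  "(\<Sum>\<xi>\<in>M. tens x \<xi> z) $ (a, b, c) = (if a = x \<and> c = z \<and> b \<in> M then 1 else 0)"
  "(\<Sum>\<xi>\<in>M. tens x y \<xi>) $ (a, b, c) = (if a = x \<and> b = y \<and> c \<in> M then 1 else 0)"
  for M :: "'x::finite set"
  by (auto simp: tens_nth intro!: sum.neutral)

lemma sum_if_const:
  "(\<Sum>x\<in>M. if P then g x else 0) = (if P then sum g M else (0 :: 'b::comm_monoid_add))"
  by simp

lemma A_one_nth: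
  "A_one adj v $ (a, b, c) = (\<Sum>x\<in>UNIV. if a \<in> gsphere adj 1 x then v $ (x, b, c) else 0)"
proof -
  have "A_one adj v $ (a, b, c) =
      (\<Sum>x\<in>UNIV. \<Sum>y\<in>UNIV. \<Sum>z\<in>UNIV.
         if z = c then (if y = b then (if a \<in> gsphere adj 1 x then v $ (x, y, z) else 0) else 0) else 0)"
    unfolding A_one_def lin_ext_nth sum_tens_nth by (intro sum.cong refl) auto
  then show ?thesis by simp
qed

lemma A_two_nth:
  "A_two adj v $ (a, b, c) = (\<Sum>y\<in>UNIV. if b \<in> gsphere adj 1 y then v $ (a, y, c) else 0)"
proof -
  have "A_two adj v $ (a, b, c) =
      (\<Sum>x\<in>UNIV. \<Sum>y\<in>UNIV. \<Sum>z\<in>UNIV.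
         if z = c then (if x = a then (if b \<in> gsphere adj 1 y then v $ (x, y, z) else 0) else 0) else 0)"
    unfolding A_two_def lin_ext_nth sum_tens_nth by (intro sum.cong refl) auto
  then show ?thesis by (simp add: sum_if_const)
qed

lemma A_three_nth:
  "A_three adj v $ (a, b, c) = (\<Sum>z\<in>UNIV. if c \<in> gsphere adj 1 z then v $ (a, b, z) else 0)"
proof -
  have "A_three adj v $ (a, b, c) =
      (\<Sum>x\<in>UNIV. \<Sum>y\<in>UNIV. \<Sum>z\<in>UNIV.
         if x = a then (if y = b then (if c \<in> gsphere adj 1 z then v $ (x, y, z) else 0) else 0) else 0)"
    unfolding A_three_def lin_ext_nth sum_tens_nth by (intro sum.cong refl) auto
  then show ?thesis by (simp add: sum_if_const)
qed

lemma B_vec_nth: "B_vec adj p $ t = (if t \<in> profile_triples adj p then 1 else 0)"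
proof -
  have "B_vec adj p $ t = (\<Sum>w\<in>profile_triples adj p. if t = w then 1 else 0)"
    unfolding B_vec_def sum_component by (intro sum.cong refl) (auto simp: tens_nth)
  then show ?thesis by simp
qed

definition triple_dists :: "('x \<Rightarrow> 'x \<Rightarrow> bool) \<Rightarrow> 'x \<times> 'x \<times> 'x \<Rightarrow> nat \<times> nat \<times> nat" where
  "triple_dists adj = (\<lambda>(x, y, z). (gdist adj x y, gdist adj y z, gdist adj z x))"

text \<open>
  Defined from the distances alone, so that a triple reached by a move has a class before it is
  known to have a profile.  The profile is then supplied by \<open>S \<subseteq> \<Lambda>\<close>; once it exists,
  this is the vector \<open>B\<close> of the profile (\<open>B_vec_eq_class_vec\<close>).
\<close>

definition class_vec :: "('x::finite \<Rightarrow> 'x \<Rightarrow> bool) \<Rightarrow> 'x \<times> 'x \<times> 'x \<Rightarrow> 'x tensor3" where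
  "class_vec adj t = (\<chi> w. if triple_dists adj w = triple_dists adj t then 1 else 0)"

lemma profile_triples_cong:
  "triple_dists adj w = triple_dists adj t \<Longrightarrow>
     w \<in> profile_triples adj p \<longleftrightarrow> t \<in> profile_triples adj p"
  by (auto simp: triple_dists_def profile_triples_def split: prod.splits)

lemma B_vec_eq_class_vec:
  assumes "t \<in> profile_triples adj p"
  shows "B_vec adj p = class_vec adj t"
  using assms
  by (auto simp: vec_eq_iff B_vec_nth class_vec_def triple_dists_def profile_triples_def
      split: prod.splits)

lemma Lambda_nth_cong:
  assumes "v \<in> Lambda adj" and "triple_dists adj w = triple_dists adj t"
  shows "v $ w = v $ t"
proof -
  have "vec.subspace {v. v $ w = v $ t}"
    by (auto simp: vec.subspace_def)
  moreover have "B_vec adj ` profiles (graph_diameter adj) \<subseteq> {v. v $ w = v $ t}"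
    using profile_triples_cong[OF assms(2)] by (auto simp: B_vec_nth)
  ultimately have "Lambda adj \<subseteq> {v. v $ w = v $ t}"
    unfolding Lambda_def by (intro vec.span_minimal)
  then show ?thesis using assms(1) by blast
qed

text \<open>The basis vector of the profile \<open>(D, 0, 0, 0)\<close> has coordinate 1 at \<open>(x, x, x)\<close>.\<close>

lemma Lambda_nontrivial: "Lambda (adj :: 'x::finite \<Rightarrow> 'x \<Rightarrow> bool) \<noteq> {0}"
proof -
  let ?p = "(graph_diameter adj, 0, 0, 0)"
  fix x :: 'x
  have "gdist adj x x = 0"
    unfolding gdist_def by (rule Least_eq_0) simp
  then have "B_vec adj ?p $ (x, x, x) \<noteq> 0"
    by (simp add: B_vec_nth profile_triples_def)
  then have "B_vec adj ?p \<noteq> 0" by auto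
  moreover have "B_vec adj ?p \<in> Lambda adj"
    unfolding Lambda_def by (intro vec.span_base imageI) (simp add: profiles_def)
  ultimately show ?thesis by blast
qed

section \<open>Cutting vectors down to one class of triples\<close>

text \<open>
  The indicator function of \<open>{t. f t = c}\<close> is the Lagrange interpolation polynomial
  \<open>\<Prod>d. (f - d) / (c - d)\<close>, with \<open>d\<close> running over the finitely many other values of \<open>f\<close>.
\<close>

lemma closed_under_restriction:
  fixes S :: "(complex ^ 'n::finite) set" and f :: "'n \<Rightarrow> complex"
  assumes S: "vec.subspace S"
    and closed: "\<And>v. v \<in> S \<Longrightarrow> (\<chi> t. f t * v $ t) \<in> S"
    and v: "v \<in> S"
  shows "(\<chi> t. if f t = c then v $ t else 0) \<in> S"
proof -
  have prod_mem: "(\<chi> t. (\<Prod>d\<in>F. (f t - d) / (c - d)) * v $ t) \<in> S" if "finite F" for F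
    using that
  proof induction
    case empty
    then show ?case using v by simp
  next
    case (insert d F)
    let ?w = "\<chi> t. (\<Prod>d\<in>F. (f t - d) / (c - d)) * v $ t"
    have "(1 / (c - d)) *s ((\<chi> t. f t * ?w $ t) - d *s ?w) \<in> S"
      by (intro vec.subspace_scale[OF S] vec.subspace_diff[OF S] closed insert.IH)
    also have "(1 / (c - d)) *s ((\<chi> t. f t * ?w $ t) - d *s ?w) =
        (\<chi> t. (\<Prod>d\<in>insert d F. (f t - d) / (c - d)) * v $ t)"
      using insert.hyps by (simp add: vec_eq_iff algebra_simps diff_divide_distrib)
    finally show ?case .
  qed
  have "(\<Prod>d\<in>range f - {c}. (f t - d) / (c - d)) = (if f t = c then 1 else 0)" for t
    by (auto intro!: prod.neutral)
  then have "(\<chi> t. if f t = c then v $ t else 0) =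
      (\<chi> t. (\<Prod>d\<in>range f - {c}. (f t - d) / (c - d)) * v $ t)"
    by (auto simp: vec_eq_iff)
  then show ?thesis using prod_mem[of "range f - {c}"] by simp
qed

lemma gdist_le_diameter:
  fixes adj :: "'x::finite \<Rightarrow> 'x \<Rightarrow> bool"
  shows "gdist adj x y \<le> graph_diameter adj"
proof -
  have "{gdist adj x y | x y. True} = range (\<lambda>(x, y). gdist adj x y)" by auto
  then have "finite {gdist adj x y | x y. True}" by simp
  then show ?thesis unfolding graph_diameter_def by (intro Max_ge) auto
qed

text \<open>
  Restricting \<open>v\<close> by each of its three distances in turn leaves the coordinates on the class of
  \<open>t\<close>; these all equal \<open>v $ t\<close>, by which one can divide.
\<close>

lemma class_vec_mem:
  fixes adj :: "'x::finite \<Rightarrow> 'x \<Rightarrow> bool"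
  assumes inj: "inj_on (theta_star adj E) {..graph_diameter adj}"
    and S: "vec.subspace S" "S \<subseteq> Lambda adj"
    and star1: "\<And>v. v \<in> S \<Longrightarrow> Astar_one adj E v \<in> S"
    and star2: "\<And>v. v \<in> S \<Longrightarrow> Astar_two adj E v \<in> S"
    and star3: "\<And>v. v \<in> S \<Longrightarrow> Astar_three adj E v \<in> S"
    and v: "v \<in> S" "v $ t \<noteq> 0"
  shows "class_vec adj t \<in> S"
proof -
  obtain x y z where t: "t = (x, y, z)" by (cases t)
  define f1 where "f1 = (\<lambda>(a :: 'x, b :: 'x, c :: 'x). theta_star adj E (gdist adj b c))"
  define f2 where "f2 = (\<lambda>(a :: 'x, b :: 'x, c :: 'x). theta_star adj E (gdist adj c a))"
  define f3 where "f3 = (\<lambda>(a :: 'x, b :: 'x, c :: 'x). theta_star adj E (gdist adj a b))"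
  have "(\<chi> t. f1 t * w $ t) = Astar_one adj E w" for w :: "'x tensor3"
    by (auto simp: vec_eq_iff f1_def Astar_one_def lin_ext_diagonal_nth)
  then have closed1: "\<And>w. w \<in> S \<Longrightarrow> (\<chi> t. f1 t * w $ t) \<in> S" using star1 by simp
  have "(\<chi> t. f2 t * w $ t) = Astar_two adj E w" for w :: "'x tensor3"
    by (auto simp: vec_eq_iff f2_def Astar_two_def lin_ext_diagonal_nth)
  then have closed2: "\<And>w. w \<in> S \<Longrightarrow> (\<chi> t. f2 t * w $ t) \<in> S" using star2 by simp
  have "(\<chi> t. f3 t * w $ t) = Astar_three adj E w" for w :: "'x tensor3"
    by (auto simp: vec_eq_iff f3_def Astar_three_def lin_ext_diagonal_nth)
  then have closed3: "\<And>w. w \<in> S \<Longrightarrow> (\<chi> t. f3 t * w $ t) \<in> S" using star3 by simp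
  define v1 where "v1 = (\<chi> w. if f1 w = f1 t then v $ w else 0)"
  define v2 where "v2 = (\<chi> w. if f2 w = f2 t then v1 $ w else 0)"
  define v3 where "v3 = (\<chi> w. if f3 w = f3 t then v2 $ w else 0)"
  have "v1 \<in> S" unfolding v1_def by (intro closed_under_restriction S(1) closed1 v(1))
  then have "v2 \<in> S" unfolding v2_def by (intro closed_under_restriction S(1) closed2)
  then have "v3 \<in> S" unfolding v3_def by (intro closed_under_restriction S(1) closed3)
  then have "(1 / v $ t) *s v3 \<in> S" by (rule vec.subspace_scale[OF S(1)])
  also have "(1 / v $ t) *s v3 = class_vec adj t"
  proof -
    have same: "f1 w = f1 t \<and> f2 w = f2 t \<and> f3 w = f3 t \<longleftrightarrow>
        triple_dists adj w = triple_dists adj t" for w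
      by (cases w) (auto simp: t f1_def f2_def f3_def triple_dists_def inj_on_eq_iff[OF inj]
          gdist_le_diameter)
    have "((1 / v $ t) *s v3) $ w = class_vec adj t $ w" for w
    proof (cases "triple_dists adj w = triple_dists adj t")
      case True
      then have "v $ w = v $ t" using Lambda_nth_cong v(1) S(2) by blast
      then show ?thesis
        using True same[of w] v(2) by (simp add: v1_def v2_def v3_def class_vec_def)
    next
      case False
      then show ?thesis
        using same[of w] by (auto simp: v1_def v2_def v3_def class_vec_def)
    qed
    then show ?thesis by (simp only: vec_eq_iff) simp
  qed
  finally show ?thesis .
qed

section \<open>Moving from class to class\<close>

lemma gdist_adjacent:
  assumes "irreflp adj" and "adj x y"
  shows "gdist adj x y = 1"
  unfolding gdist_def
proof (rule Least_equality)
  show "(adj ^^ 1) x y" using assms(2) by (auto simp: OO_def)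
  fix n assume "(adj ^^ n) x y"
  then show "1 \<le> n" using assms by (cases n) (auto dest: irreflpD)
qed

text \<open>
  The coordinates of the image of a class vector under one of the \<open>A\<close> count vertices, so they
  cannot vanish by cancellation.
\<close>

lemma sum_indicator_neq_0:
  fixes P :: "'a::finite \<Rightarrow> bool"
  shows "(\<Sum>x\<in>UNIV. if P x then (if Q x then 1 else 0) else 0 :: complex) \<noteq> 0 \<longleftrightarrow>
    (\<exists>x. P x \<and> Q x)"
proof -
  have "(\<Sum>x\<in>UNIV. if P x then (if Q x then 1 else 0) else 0 :: complex) =
      (\<Sum>x\<in>UNIV. if P x \<and> Q x then 1 else 0)"
    by (intro sum.cong) auto
  also have "\<dots> = of_nat (card {x. P x \<and> Q x})"
    by (simp add: sum.If_cases)
  finally show ?thesis by auto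
qed

lemma invariant_subspace_eq_Lambda:
  fixes adj :: "'x::finite \<Rightarrow> 'x \<Rightarrow> bool"
  assumes graph: "irreflp adj" "connected_graph adj"
    and inj: "inj_on (theta_star adj E) {..graph_diameter adj}"
    and S: "vec.subspace S" "S \<subseteq> Lambda adj" "S \<noteq> {0}"
    and A1: "\<And>v. v \<in> S \<Longrightarrow> A_one adj v \<in> S"
    and A2: "\<And>v. v \<in> S \<Longrightarrow> A_two adj v \<in> S"
    and A3: "\<And>v. v \<in> S \<Longrightarrow> A_three adj v \<in> S"
    and star: "\<And>v. v \<in> S \<Longrightarrow> Astar_one adj E v \<in> S"
      "\<And>v. v \<in> S \<Longrightarrow> Astar_two adj E v \<in> S"
      "\<And>v. v \<in> S \<Longrightarrow> Astar_three adj E v \<in> S"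
  shows "S = Lambda adj"
proof -
  have class_mem: "class_vec adj t \<in> S" if "v \<in> S" "v $ t \<noteq> 0" for v t
    using that by (intro class_vec_mem[OF inj S(1,2), of v t] star)
  have sphere: "y \<in> gsphere adj 1 x" if "adj x y" for x y
    using gdist_adjacent[OF graph(1) that] by (simp add: gsphere_def)
  have step1: "class_vec adj (x', y, z) \<in> S" if "class_vec adj (x, y, z) \<in> S" "adj x x'"
    for x x' y z
  proof (rule class_mem[OF A1[OF that(1)]])
    show "A_one adj (class_vec adj (x, y, z)) $ (x', y, z) \<noteq> 0"
      unfolding A_one_nth class_vec_def vec_lambda_beta sum_indicator_neq_0
      using sphere[OF that(2)] by blast
  qed
  have step2: "class_vec adj (x, y', z) \<in> S" if "class_vec adj (x, y, z) \<in> S" "adj y y'"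
    for x y y' z
  proof (rule class_mem[OF A2[OF that(1)]])
    show "A_two adj (class_vec adj (x, y, z)) $ (x, y', z) \<noteq> 0"
      unfolding A_two_nth class_vec_def vec_lambda_beta sum_indicator_neq_0
      using sphere[OF that(2)] by blast
  qed
  have step3: "class_vec adj (x, y, z') \<in> S" if "class_vec adj (x, y, z) \<in> S" "adj z z'"
    for x y z z'
  proof (rule class_mem[OF A3[OF that(1)]])
    show "A_three adj (class_vec adj (x, y, z)) $ (x, y, z') \<noteq> 0"
      unfolding A_three_nth class_vec_def vec_lambda_beta sum_indicator_neq_0
      using sphere[OF that(2)] by blast
  qed
  have conn: "adj\<^sup>*\<^sup>* x y" for x y
    using graph(2) by (simp add: connected_graph_def)
  have walk1: "class_vec adj (x', y, z) \<in> S" if "class_vec adj (x, y, z) \<in> S" for x x' y z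
    using conn[of x x'] by induction (auto intro: that step1)
  have walk2: "class_vec adj (x, y', z) \<in> S" if "class_vec adj (x, y, z) \<in> S" for x y y' z
    using conn[of y y'] by induction (auto intro: that step2)
  have walk3: "class_vec adj (x, y, z') \<in> S" if "class_vec adj (x, y, z) \<in> S" for x y z z'
    using conn[of z z'] by induction (auto intro: that step3)
  have "0 \<in> S" using S(1) by (rule vec.subspace_0)
  then obtain v where v: "v \<in> S" "v \<noteq> 0" using S(3) by blast
  then obtain t where "v $ t \<noteq> 0" by (auto simp: vec_eq_iff)
  with v have "class_vec adj t \<in> S" by (intro class_mem)
  then have all: "class_vec adj w \<in> S" for w
    by (cases t, cases w) (metis walk1 walk2 walk3)
  \<comment> \<open>A profile that no triple has contributes the zero vector.\<close>
  have "B_vec adj p \<in> S" for p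
  proof (cases "profile_triples adj p = {}")
    case True
    then have "B_vec adj p = 0" by (simp add: vec_eq_iff B_vec_nth)
    then show ?thesis using \<open>0 \<in> S\<close> by simp
  next
    case False
    then obtain t where "t \<in> profile_triples adj p" by blast
    then show ?thesis using all by (simp add: B_vec_eq_class_vec)
  qed
  then have "Lambda adj \<subseteq> S"
    unfolding Lambda_def by (intro vec.span_minimal S(1)) auto
  then show ?thesis using S(2) by blast
qed

section \<open>Scalars that are nonzero because \<open>q\<close> is not a root of unity\<close>

context
  fixes q :: complex
  assumes q_nz: "q \<noteq> 0" and q_not_root: "\<forall>n\<ge>1. q ^ n \<noteq> 1"
begin

lemma powi_eq_1_imp: "q powi k = 1 \<Longrightarrow> k = 0"
proof (rule ccontr)
  assume k: "q powi k = 1" "k \<noteq> 0"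
  have "q ^ nat \<bar>k\<bar> = 1"
    using k(1) by (cases "k \<ge> 0") (auto simp: power_int_def power_inverse)
  then show False using q_not_root k(2) by auto
qed

text \<open>If \<open>q\<^sup>k = -1\<close> then \<open>q\<^sup>2\<^sup>k = 1\<close>, so \<open>k = 0\<close>, and \<open>1 = -1\<close>.\<close>

lemma powi_neq_minus_1: "q powi k \<noteq> -1"
proof
  assume k: "q powi k = -1"
  have "q powi (k + k) = 1" using q_nz by (subst power_int_add) (simp_all add: k)
  then have "k = 0" using powi_eq_1_imp by fastforce
  then show False using k by simp
qed

lemma powi_minus_2_neq_powi_2: "q powi (-2) \<noteq> q powi 2"
proof
  assume "q powi (-2) = q powi 2"
  then have "q powi (2 - (-2)) = 1" using q_nz by (subst power_int_diff) auto
  then show False using powi_eq_1_imp[of "2 - (-2)"] by simp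
qed

lemma H_const_neq_0: "H_const D q \<noteq> 0"
proof -
  define k where "k = int D - 2"
  have "q powi k + q powi (- k) \<noteq> 0"
  proof
    assume "q powi k + q powi (- k) = 0"
    then have "q powi k = - (q powi (- k))" by (simp add: add_eq_0_iff)
    then have "q powi (k - (- k)) = -1" using q_nz by (subst power_int_diff) auto
    then show False using powi_neq_minus_1 by blast
  qed
  then have "q powi (int D - 2) + q powi (2 - int D) \<noteq> 0"
    by (simp add: k_def)
  then show ?thesis
    using powi_minus_2_neq_powi_2 unfolding H_const_def by simp
qed

text \<open>
  With \<open>a = q\<^bsup>D-2i\<^esup>\<close> and \<open>b = q\<^bsup>D-2j\<^esup>\<close>, the equation \<open>a - 1/a = b - 1/b\<close> says
  \<open>(a - b) (ab + 1) = 0\<close>; the second factor is nonzero because \<open>ab\<close> is a power of \<open>q\<close>.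
\<close>

lemma theta_star_formula_inj:
  assumes "q powi (int D - 2 * int i) - q powi (2 * int i - int D) =
      q powi (int D - 2 * int j) - q powi (2 * int j - int D)"
  shows "i = j"
proof -
  define k l where "k = int D - 2 * int i" and "l = int D - 2 * int j"
  define a b where "a = q powi k" and "b = q powi l"
  have nz: "a \<noteq> 0" "b \<noteq> 0" using q_nz by (simp_all add: a_def b_def)
  have inv: "q powi (2 * int i - int D) = 1 / a" "q powi (2 * int j - int D) = 1 / b"
    using power_int_minus[of q k] power_int_minus[of q l]
    by (simp_all add: a_def b_def k_def l_def field_simps)
  have "a - 1 / a = b - 1 / b"
    using assms unfolding inv by (simp add: a_def b_def k_def l_def)
  then have "(a - b) * (a * b + 1) = 0" using nz by (simp add: field_simps)
  moreover have "a * b + 1 \<noteq> 0"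
    using powi_neq_minus_1[of "k + l"] q_nz
    by (simp add: a_def b_def power_int_add eq_neg_iff_add_eq_0)
  ultimately have "a = b" by simp
  then have "q powi (k - l) = 1" using q_nz nz by (simp add: a_def b_def power_int_diff)
  then show ?thesis using powi_eq_1_imp[of "k - l"] by (simp add: k_def l_def)
qed

end

section \<open>Irreducibility\<close>

lemma Uclass_carrier: "Uclass q f \<in> carrier (Uq_so6 q)"
  by (auto simp: Uclass_def Uq_so6_def FactRing_def A_RCOSETS_def' free_ring_def)


theorem lemma10p18:
  fixes adj :: "'x::finite \<Rightarrow> 'x \<Rightarrow> bool"
    and E :: "nat \<Rightarrow> complex ^ 'x ^ 'x"
    and D :: nat
    and q H :: complex
    and act :: "so6_free set \<Rightarrow> 'x tensor3 \<Rightarrow> 'x tensor3"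
  assumes "CARD('x) \<ge> 2"
    and "distance_regular adj"
    and "D = graph_diameter adj" and "D \<ge> 3"
    and "two_homogeneous adj" and "\<not> is_hypercube adj" and "\<not> is_cycle adj"
    and "Q_poly_ordering adj E"
    and "q \<noteq> 0" and "\<forall>n\<ge>1. q ^ n \<noteq> 1"
    and "H = H_const D q"
    and "\<forall>i\<le>D. theta_eig adj E i =
           H * \<i> * (q powi (int D - 2 * int i) - q powi (2 * int i - int D))"
    and "\<forall>i\<le>D. theta_star adj E i =
           H * \<i> * (q powi (int D - 2 * int i) - q powi (2 * int i - int D))"
    and "\<forall>i\<le>D. of_nat (c_num adj i) =
           H * \<i> * (q powi (2 * int i) - q powi (- 2 * int i))
             / (q powi (int D - 2 * int i) + q powi (2 * int i - int D))"
    and "\<forall>i\<le>D. of_nat (b_num adj i) =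
           H * \<i> * (q powi (2 * int D - 2 * int i) - q powi (2 * int i - 2 * int D))
             / (q powi (int D - 2 * int i) + q powi (2 * int i - int D))"
    and "Uq_module q (Lambda adj) act"
    and "\<forall>v\<in>Lambda adj. act (Uclass q (fgen G1)) v = (1 / (H * (q powi 2 - q powi (-2)))) *s A_one adj v"
    and "\<forall>v\<in>Lambda adj. act (Uclass q (fgen G3)) v = (1 / (H * (q powi 2 - q powi (-2)))) *s A_two adj v"
    and "\<forall>v\<in>Lambda adj. act (Uclass q (fgen G5)) v = (1 / (H * (q powi 2 - q powi (-2)))) *s A_three adj v"
    and "\<forall>v\<in>Lambda adj. act (Uclass q (fgen G2)) v = (1 / (H * (q powi (-2) - q powi 2))) *s Astar_three adj E v"
    and "\<forall>v\<in>Lambda adj. act (Uclass q (fgen G4)) v = (1 / (H * (q powi (-2) - q powi 2))) *s Astar_one adj E v"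
    and "\<forall>v\<in>Lambda adj. act (Uclass q (fB6 q)) v = (1 / (H * (q powi (-2) - q powi 2))) *s Astar_two adj E v"
  shows "Uq_irreducible q (Lambda adj) act"
proof -
  have H: "H \<noteq> 0" using H_const_neq_0 assms(9,10,11) by simp
  have denom: "H * (q powi 2 - q powi (-2)) \<noteq> 0" "H * (q powi (-2) - q powi 2) \<noteq> 0"
    using H powi_minus_2_neq_powi_2[OF assms(9,10)] by auto
  have inj: "inj_on (theta_star adj E) {..graph_diameter adj}"
  proof (rule inj_onI)
    fix i j
    assume "i \<in> {..graph_diameter adj}" "j \<in> {..graph_diameter adj}"
      "theta_star adj E i = theta_star adj E j"
    then show "i = j"
      using assms(3,13) H by (intro theta_star_formula_inj[OF assms(9,10), of D]) auto
  qed
  have graph: "irreflp adj" "connected_graph adj"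
    using assms(2) by (auto simp: distance_regular_def simple_graph_def)
  have "S = Lambda adj" if sub: "Uq_submodule q (Lambda adj) act S" and nz: "S \<noteq> {0}" for S
  proof -
    have S: "vec.subspace S" "S \<subseteq> Lambda adj"
      using sub by (auto simp: Uq_submodule_def)
    have closed: "T v \<in> S"
      if T: "\<forall>v\<in>Lambda adj. act (Uclass q f) v = (1 / c) *s T v" and "c \<noteq> 0" "v \<in> S" for T f c v
    proof -
      have "act (Uclass q f) v \<in> S"
        using sub \<open>v \<in> S\<close> Uclass_carrier by (auto simp: Uq_submodule_def)
      then have "(1 / c) *s T v \<in> S" using T \<open>v \<in> S\<close> S(2) by auto
      then have "c *s ((1 / c) *s T v) \<in> S" by (rule vec.subspace_scale[OF S(1)])
      then show ?thesis using \<open>c \<noteq> 0\<close> by simp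
    qed
    show ?thesis
      by (rule invariant_subspace_eq_Lambda[OF graph inj S nz])
         (fact closed[OF assms(17) denom(1)] closed[OF assms(18) denom(1)]
            closed[OF assms(19) denom(1)] closed[OF assms(21) denom(2)]
            closed[OF assms(22) denom(2)] closed[OF assms(20) denom(2)])+
  qed
  then show ?thesis
    using Lambda_nontrivial unfolding Uq_irreducible_def by blast
qed

end
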